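(* Let $X$ be a Banach space and let $(A_n)_{n\in\mathbb{N}}\subset B(X)$. Let $(a_{m,n})_{(m,n)\in\mathbb{N}^2_{\geqslant}}$ and $(b_{m,n})_{(m,n)\in\mathbb{N}^2_{\leqslant}}$ be double sequences of positive real numbers. Suppose that the equation $x_{m+1}=A_mx_m$, $m\in\mathbb{N}$, admits a general dichotomy with bounds $(a_{m,n})$ and $(b_{m,n})$ such that $$\sup_{m\geqslant j}\frac{a_{m,n}}{a_{m,j}}<+\infty\quad\text{for every }(j,n)\in\mathbb{N}^2_{\geqslant}.$$ Let $(B_n)_{n\in\mathbb{N}}\subset B(X)$ and put $$\lambda'_{m,n}=\sum_{k=1}^{n-1}a_{m,k+1}\|B_k\|b_{k,n}+\sum_{k=n}^{m-1}a_{m,k+1}\|B_k\|a_{k,n}+\sum_{k=m}^{+\infty}b_{m,k+1}\|B_k\|a_{k,n},\quad (m,n)\in\mathbb{N}^2_{\geqslant},$$ $$\mu'_{m,n}=\sum_{k=1}^{m-1}a_{m,k+1}\|B_k\|b_{k,n}+\sum_{k=m}^{n-1}b_{m,k+1}\|B_k\|b_{k,n}+\sum_{k=n}^{+\infty}b_{m,k+1}\|B_k\|a_{k,n},\quad (m,n)\in\mathbb{N}^2_{\leqslant}.$$ If $$\theta:=\max\left\{\sup_{(m,n)\in\mathbb{N}^2_{\geqslant}}\frac{\lambda'_{m,n}}{a_{m,n}},\ \sup_{(m,n)\in\mathbb{N}^2_{\leqslant}}\frac{\mu'_{m,n}}{b_{m,n}}\right\}<1,$$ then the equation $x_{m+1}=(A_m+B_m)x_m$,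 $m\in\mathbb{N}$, admits a general dichotomy with bounds $(\sigma a_{m,n})$ and $(\sigma b_{m,n})$, where $\sigma=1/(1-\theta)$.
   Context: $\mathbb{N}=\{1,2,3,\dots\}$; $B(X)$ is the space of bounded linear operators on the Banach space $X$. $\mathbb{N}^2_{\geqslant}=\{(m,n)\in\mathbb{N}^2: m\geqslant n\}$ and $\mathbb{N}^2_{\leqslant}=\{(m,n)\in\mathbb{N}^2: m\leqslant n\}$. Empty sums equal $0$. For $(A_n)_{n\in\mathbb{N}}\subset B(X)$ and $m\geqslant n$, put $\mathcal{A}_{m,n}=A_{m-1}\cdots A_n$ if $m>n$ and $\mathcal{A}_{n,n}=\mathrm{Id}$. The equation $x_{m+1}=A_mx_m$, $m\in\mathbb{N}$, admits an invariant splitting if there are bounded projections $P_n\in B(X)$, $n\in\mathbb{N}$, such that for every $(m,n)\in\mathbb{N}^2_{\geqslant}$: (S1) $P_m\mathcal{A}_{m,n}=\mathcal{A}_{m,n}P_n$; (S2) $\mathcal{A}_{m,n}(\ker P_n)=\ker P_m$; (S3) $\mathcal{A}_{m,n}|_{\ker P_n}:\ker P_n\to\ker P_m$ is invertible (with bounded inverse). In that case, for $m\geqslant n$, $\mathcal{A}_{n,m}:\ker P_m\to\ker P_n$ denotes the inverse of $\mathcal{A}_{m,n}|_{\ker P_n}$, and $Q_n=\mathrm{Id}-P_n$. The equation admits a general dichotomy with bounds $(a_{m,n})_{(m,n)\in\mathbb{N}^2_{\geqslant}}$ and $(b_{m,n})_{(m,n)\in\mathbb{N}^2_{\leqslant}}$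 if it admits an invariant splitting such that (D1) $\|\mathcal{A}_{m,n}P_n\|\leqslant a_{m,n}$ for all $(m,n)\in\mathbb{N}^2_{\geqslant}$ and (D2) $\|\mathcal{A}_{m,n}Q_n\|\leqslant b_{m,n}$ for all $(m,n)\in\mathbb{N}^2_{\leqslant}$. *)

theory Defs
  imports "HOL-Analysis.Analysis"
begin

text \<open>
  Sequences indexed by \<open>\<nat> = {1, 2, 3, \<dots>}\<close> are functions on \<^typ>\<open>nat\<close> whose value
  at \<open>0\<close> is never constrained; likewise double sequences are only ever used on
  the index sets below.
\<close>

definition idx_ge :: "(nat \<times> nat) set" where
  "idx_ge = {(m, n). 1 \<le> n \<and> n \<le> m}"

definition idx_le :: "(nat \<times> nat) set" where
  "idx_le = {(m, n). 1 \<le> m \<and> m \<le> n}"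

definition ker :: "('a::real_normed_vector \<Rightarrow>\<^sub>L 'b::real_normed_vector) \<Rightarrow> 'a set" where
  "ker T = {x. blinfun_apply T x = 0}"

text \<open>For \<open>m \<ge> n\<close>, \<open>evol A m n\<close> is \<open>A (m - 1) \<cdots> A n\<close>; it is meaningless for \<open>m < n\<close>.\<close>

primrec evol :: "(nat \<Rightarrow> 'a::real_normed_vector \<Rightarrow>\<^sub>L 'a) \<Rightarrow> nat \<Rightarrow> nat \<Rightarrow> 'a \<Rightarrow>\<^sub>L 'a" where
  "evol A 0 n = id_blinfun"
| "evol A (Suc m) n = (if n \<le> m then A m o\<^sub>L evol A m n else id_blinfun)"

text \<open>For \<open>m \<le> n\<close>, \<open>evol_back A P m n\<close> inverts \<open>evol A n m\<close> restricted to \<open>ker (P m)\<close>;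
  only its values on \<open>ker (P n)\<close> are meaningful.\<close>

definition evol_back ::
    "(nat \<Rightarrow> 'a::real_normed_vector \<Rightarrow>\<^sub>L 'a) \<Rightarrow> (nat \<Rightarrow> 'a \<Rightarrow>\<^sub>L 'a) \<Rightarrow> nat \<Rightarrow> nat \<Rightarrow> 'a \<Rightarrow> 'a" where
  "evol_back A P m n = inv_into (ker (P m)) (blinfun_apply (evol A n m))"

definition invariant_splitting ::
    "(nat \<Rightarrow> 'a::real_normed_vector \<Rightarrow>\<^sub>L 'a) \<Rightarrow> (nat \<Rightarrow> 'a \<Rightarrow>\<^sub>L 'a) \<Rightarrow> bool" where
  "invariant_splitting A P \<longleftrightarrow>
     (\<forall>n\<ge>1. P n o\<^sub>L P n = P n) \<and>
     (\<forall>(m, n) \<in> idx_ge.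
        P m o\<^sub>L evol A m n = evol A m n o\<^sub>L P n \<and>
        blinfun_apply (evol A m n) ` ker (P n) = ker (P m) \<and>
        bij_betw (blinfun_apply (evol A m n)) (ker (P n)) (ker (P m)) \<and>
        (\<exists>C. \<forall>y \<in> ker (P m). norm (evol_back A P n m y) \<le> C * norm y))"

definition general_dichotomy ::
    "(nat \<Rightarrow> 'a::real_normed_vector \<Rightarrow>\<^sub>L 'a) \<Rightarrow> (nat \<Rightarrow> nat \<Rightarrow> real) \<Rightarrow> (nat \<Rightarrow> nat \<Rightarrow> real) \<Rightarrow> bool" where
  "general_dichotomy A a b \<longleftrightarrow>
     (\<exists>P. invariant_splitting A P \<and>
        (\<forall>(m, n) \<in> idx_ge. norm (evol A m n o\<^sub>L P n) \<le> a m n) \<and>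
        (\<forall>(m, n) \<in> idx_le.
           onorm (\<lambda>x. evol_back A P m n (blinfun_apply (id_blinfun - P n) x)) \<le> b m n))"

text \<open>\<^const>\<open>onorm\<close> is the operator norm only for bounded linear maps, so we check that
  it is applied to one above.\<close>

lemma bounded_linear_evol_back:
  assumes S: "invariant_splitting A P" and mn: "(m, n) \<in> idx_le"
  shows "bounded_linear (\<lambda>x. evol_back A P m n (blinfun_apply (id_blinfun - P n) x))"
proof -
  let ?E = "blinfun_apply (evol A n m)" and ?Q = "blinfun_apply (id_blinfun - P n)"
  let ?g = "evol_back A P m n"
  have nm: "(n, m) \<in> idx_ge" and n1: "1 \<le> n"
    using mn by (auto simp: idx_ge_def idx_le_def)
  have bij: "bij_betw ?E (ker (P m)) (ker (P n))"
    and "\<exists>C. \<forall>y \<in> ker (P n). norm (?g y) \<le> C * norm y"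
    using S nm by (auto simp: invariant_splitting_def)
  then obtain C where C: "\<And>y. y \<in> ker (P n) \<Longrightarrow> norm (?g y) \<le> C * norm y" by blast
  have idem: "P n o\<^sub>L P n = P n"
    using S n1 by (auto simp: invariant_splitting_def)
  have Q: "?Q x \<in> ker (P n)" for x
  proof -
    have "blinfun_apply (P n) (blinfun_apply (P n) x) = blinfun_apply (P n) x"
      using arg_cong[OF idem, of "\<lambda>T. blinfun_apply T x"] by simp
    then show ?thesis
      by (simp add: ker_def blinfun.diff_left blinfun.diff_right)
  qed
  have g: "?g y \<in> ker (P m)" "?E (?g y) = y" if "y \<in> ker (P n)" for y
    using bij_betw_inv_into_right[OF bij that] bij_betw_apply[OF bij_betw_inv_into[OF bij] that]
    by (auto simp: evol_back_def)
  have eq: "?g y = x" if "x \<in> ker (P m)" "?E x = y" for x y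
    using bij_betw_inv_into_left[OF bij that(1)] that(2) by (simp add: evol_back_def)
  show ?thesis
  proof (rule bounded_linear_intro[where K = "\<bar>C\<bar> * norm (id_blinfun - P n)"])
    fix x y
    show "?g (?Q (x + y)) = ?g (?Q x) + ?g (?Q y)"
      using g[OF Q[of x]] g[OF Q[of y]]
      by (intro eq) (simp_all add: ker_def blinfun.add_right)
  next
    fix r x
    show "?g (?Q (r *\<^sub>R x)) = r *\<^sub>R ?g (?Q x)"
      using g[OF Q[of x]] by (intro eq) (simp_all add: ker_def blinfun.scaleR_right)
  next
    fix x
    have "norm (?g (?Q x)) \<le> C * norm (?Q x)" by (rule C[OF Q])
    also have "\<dots> \<le> \<bar>C\<bar> * norm (?Q x)" by (intro mult_right_mono) auto
    also have "\<dots> \<le> \<bar>C\<bar> * (norm (id_blinfun - P n) * norm x)"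
      by (intro mult_left_mono norm_blinfun) auto
    finally show "norm (?g (?Q x)) \<le> norm x * (\<bar>C\<bar> * norm (id_blinfun - P n))"
      by (simp add: mult_ac)
  qed
qed

text \<open>The series below may diverge, so they are formed in \<^typ>\<open>ennreal\<close>; each series
  over \<open>k \<ge> m\<close> (resp. \<open>k \<ge> n\<close>) is written with \<open>k\<close> shifted to start at \<open>0\<close>.\<close>

definition lambda' ::
    "(nat \<Rightarrow> nat \<Rightarrow> real) \<Rightarrow> (nat \<Rightarrow> nat \<Rightarrow> real) \<Rightarrow> (nat \<Rightarrow> 'a::real_normed_vector \<Rightarrow>\<^sub>L 'a)
      \<Rightarrow> nat \<Rightarrow> nat \<Rightarrow> ennreal" where
  "lambda' a b B m n =
     (\<Sum>k\<in>{1..<n}. ennreal (a m (k + 1) * norm (B k) * b k n)) +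
     (\<Sum>k\<in>{n..<m}. ennreal (a m (k + 1) * norm (B k) * a k n)) +
     (\<Sum>k. ennreal (b m (m + k + 1) * norm (B (m + k)) * a (m + k) n))"

definition mu' ::
    "(nat \<Rightarrow> nat \<Rightarrow> real) \<Rightarrow> (nat \<Rightarrow> nat \<Rightarrow> real) \<Rightarrow> (nat \<Rightarrow> 'a::real_normed_vector \<Rightarrow>\<^sub>L 'a)
      \<Rightarrow> nat \<Rightarrow> nat \<Rightarrow> ennreal" where
  "mu' a b B m n =
     (\<Sum>k\<in>{1..<m}. ennreal (a m (k + 1) * norm (B k) * b k n)) +
     (\<Sum>k\<in>{m..<n}. ennreal (b m (k + 1) * norm (B k) * b k n)) +
     (\<Sum>k. ennreal (b m (n + k + 1) * norm (B (n + k)) * a (n + k) n))"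

end

theory Submission
  imports Defs
begin

text \<open>
  Let \<open>G m n\<close> be the Green function of the dichotomy: \<open>\<A>\<^bsub>m,n\<^esub> P\<^sub>n\<close> for \<open>m \<ge> n\<close> and
  \<open>- \<A>\<^bsub>m,n\<^esub> Q\<^sub>n\<close> for \<open>m < n\<close>. The hypothesis \<open>\<theta> < 1\<close> says that
  \<open>Z \<mapsto> (\<lambda>m. \<Sum>k. G m (k + 1) B\<^sub>k Z\<^sub>k)\<close> is a \<open>\<theta>\<close>-contraction for the norms weighted by
  \<open>w m n\<close> (\<open>a m n\<close> for \<open>m \<ge> n\<close>, \<open>b m n\<close> for \<open>m < n\<close>), so that for each \<open>n\<close> the equation
  \<open>H m n = G m n + (\<Sum>k. G m (k + 1) B\<^sub>k (H k n))\<close> has a unique solution, of weighted norm at most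
  \<open>1 / (1 - \<theta>)\<close>. It is the Green function of the perturbed equation, with projections \<open>H n n\<close>.
  The needed algebraic identities follow from uniqueness: \<open>H m j H j n\<close> equals \<open>H m n\<close> for
  \<open>m \<ge> j \<ge> n\<close> and \<open>0\<close> for \<open>m < j\<close>, and a solution of the perturbed equation starting in
  \<open>ker P\<^sub>1\<close> is annihilated by \<open>H\<close> at the present and later times. Hence the perturbed unstable space
  at time \<open>m\<close> is the image of \<open>ker P\<^sub>1\<close> under the perturbed evolution, and invertibility on it
  is witnessed by \<open>- H\<close> itself.
\<close>

section \<open>Perturbing an abstract Green function\<close>

interpretation blinfun_compose: bounded_bilinear "(o\<^sub>L)"
  by (rule bounded_bilinear_blinfun_compose)

lemma blinfun_compose_assoc: "(X o\<^sub>L Y) o\<^sub>L Z = X o\<^sub>L (Y o\<^sub>L Z)"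
  by (rule blinfun_eqI) simp

lemma blinfun_compose_id [simp]: "id_blinfun o\<^sub>L X = X" "X o\<^sub>L id_blinfun = X"
  by (auto intro: blinfun_eqI)

lemma evol_same [simp]: "evol A n n = id_blinfun"
  by (cases n) auto

lemma evol_comp:
  assumes "n \<le> j" "j \<le> m"
  shows "evol A m j o\<^sub>L evol A j n = evol A m n"
  using assms(2,1) by (induction m rule: dec_induct) (auto simp: blinfun_compose_assoc)

lemma evol_apply_evol:
  "\<lbrakk>n \<le> j; j \<le> m\<rbrakk> \<Longrightarrow>
    blinfun_apply (evol A m j) (blinfun_apply (evol A j n) x) = blinfun_apply (evol A m n) x"
  by (metis evol_comp blinfun_apply_blinfun_compose)

lemma norm_comp3:
  "norm (X o\<^sub>L Y o\<^sub>L Z) \<le> norm X * norm Y * norm Z"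
  by (meson norm_blinfun_compose mult_right_mono norm_ge_zero order_trans)

text \<open>\<open>B 0 = 0\<close> removes the meaningless index \<open>k = 0\<close> from the series. The bound \<open>c n\<close> is
  \<open>b n n\<close>, which \<open>w n n = a n n\<close> does not record.\<close>

locale perturbed_green =
  fixes A B :: "nat \<Rightarrow> 'a::banach \<Rightarrow>\<^sub>L 'a" and G :: "nat \<Rightarrow> nat \<Rightarrow> 'a \<Rightarrow>\<^sub>L 'a"
    and w :: "nat \<Rightarrow> nat \<Rightarrow> real" and c :: "nat \<Rightarrow> real" and \<theta> :: real
  assumes theta_nonneg: "0 \<le> \<theta>" and theta_less_1: "\<theta> < 1"
    and B_0 [simp]: "B 0 = 0"
    and w_pos: "\<lbrakk>1 \<le> m; 1 \<le> n\<rbrakk> \<Longrightarrow> 0 < w m n"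
    and norm_G: "\<lbrakk>1 \<le> m; 1 \<le> n\<rbrakk> \<Longrightarrow> norm (G m n) \<le> w m n"
    and norm_id_minus_G: "1 \<le> n \<Longrightarrow> norm (id_blinfun - G n n) \<le> c n"
    and G_Suc_left: "\<lbrakk>1 \<le> m; 1 \<le> n\<rbrakk> \<Longrightarrow>
          G (Suc m) n = (A m o\<^sub>L G m n) + (if n = Suc m then id_blinfun else 0)"
    and G_Suc_right: "\<lbrakk>1 \<le> m; 1 \<le> n\<rbrakk> \<Longrightarrow>
          G m (Suc n) o\<^sub>L A n = G m n - (if m = n then id_blinfun else 0)"
    and G_comp: "\<lbrakk>1 \<le> m; 1 \<le> j; 1 \<le> k\<rbrakk> \<Longrightarrow>
          G m j o\<^sub>L G j k = (if k \<le> j then G m k else 0) - (if m < j then G m k else 0)"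
    and summable_w: "\<lbrakk>1 \<le> m; 1 \<le> n\<rbrakk> \<Longrightarrow> summable (\<lambda>k. w m (Suc k) * norm (B k) * w k n)"
    and suminf_w: "\<lbrakk>1 \<le> m; 1 \<le> n\<rbrakk> \<Longrightarrow>
          (\<Sum>k. w m (Suc k) * norm (B k) * w k n) \<le> \<theta> * w m n"
    and suminf_w_diag: "1 \<le> n \<Longrightarrow> (\<Sum>k. w n (Suc k) * norm (B k) * w k n) \<le> \<theta> * c n"
    and w_quotient_bounded: "\<lbrakk>1 \<le> n; n \<le> j\<rbrakk> \<Longrightarrow> \<exists>K. \<forall>m\<ge>j. w m n \<le> K * w m j"
begin

section \<open>Weighted supremum bounds and the operator \<open>T\<close>\<close>

definition dominated :: "nat \<Rightarrow> real \<Rightarrow> (nat \<Rightarrow> 'a \<Rightarrow>\<^sub>L 'a) \<Rightarrow> bool" where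
  "dominated n K Z \<longleftrightarrow> (\<forall>k\<ge>1. norm (Z k) \<le> K * w k n)"

text \<open>The Green operator of the unperturbed equation, applied to the inhomogeneity that
  \<open>B\<close> produces from \<open>Z\<close>. As \<open>suminf\<close> is total, the value is
  meaningful only where the series converges, which domination of \<open>Z\<close> ensures.\<close>

definition T :: "(nat \<Rightarrow> 'a \<Rightarrow>\<^sub>L 'a) \<Rightarrow> nat \<Rightarrow> 'a \<Rightarrow>\<^sub>L 'a" where
  "T Z m = (\<Sum>k. G m (Suc k) o\<^sub>L B k o\<^sub>L Z k)"

lemma norm_T_term:
  assumes "1 \<le> m" "dominated n K Z"
  shows "norm (G m (Suc k) o\<^sub>L B k o\<^sub>L Z k) \<le> K * (w m (Suc k) * norm (B k) * w k n)"
\<comment> \<open>At \<open>k = 0\<close> neither \<open>w\<close> nor \<open>Z\<close> is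
  controlled; both sides vanish because \<open>B 0 = 0\<close>.\<close>
proof (cases "k = 0")
  case False
  have "norm (G m (Suc k) o\<^sub>L B k o\<^sub>L Z k) \<le> norm (G m (Suc k)) * norm (B k) * norm (Z k)"
    by (rule norm_comp3)
  also have "\<dots> \<le> w m (Suc k) * norm (B k) * (K * w k n)"
    using False assms norm_G[of m "Suc k"] w_pos[of m "Suc k"] unfolding dominated_def
    by (intro mult_mono mult_nonneg_nonneg) auto
  finally show ?thesis by (simp add: mult_ac)
qed simp

lemma summable_T:
  assumes "1 \<le> m" "1 \<le> n" "dominated n K Z"
  shows "summable (\<lambda>k. G m (Suc k) o\<^sub>L B k o\<^sub>L Z k)"
  using norm_T_term[OF assms(1,3)] assms
  by (intro summable_comparison_test'[OF summable_mult[OF summable_w[of m n], of K]]) auto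

text \<open>The series is kept in the bound so that it can be estimated by
  \<open>\<theta> * w m n\<close> in general and by \<open>\<theta> * c n\<close> on the
  diagonal.\<close>

lemma norm_T:
  assumes "1 \<le> m" "1 \<le> n" "dominated n K Z"
  shows "norm (T Z m) \<le> K * (\<Sum>k. w m (Suc k) * norm (B k) * w k n)"
proof -
  have s: "summable (\<lambda>k. K * (w m (Suc k) * norm (B k) * w k n))"
    using assms by (intro summable_mult summable_w)
  have "norm (T Z m) \<le> (\<Sum>k. K * (w m (Suc k) * norm (B k) * w k n))"
    unfolding T_def by (rule norm_suminf_le[OF norm_T_term[OF assms(1,3)] s])
  also have "\<dots> = K * (\<Sum>k. w m (Suc k) * norm (B k) * w k n)"
    using assms by (intro suminf_mult summable_w)
  finally show ?thesis .
qed

lemma dominated_nonneg: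
  assumes "1 \<le> n" "dominated n K Z"
  shows "0 \<le> K"
proof -
  have "0 \<le> K * w 1 n"
    using assms norm_ge_zero[of "Z 1"] unfolding dominated_def
    by (meson order_trans order_refl)
  with w_pos[of 1 n] assms show ?thesis by (simp add: zero_le_mult_iff)
qed

lemma dominated_T:
  assumes "1 \<le> n" "dominated n K Z"
  shows "dominated n (\<theta> * K) (T Z)"
  unfolding dominated_def
proof (intro allI impI)
  fix m :: nat assume m: "1 \<le> m"
  have "norm (T Z m) \<le> K * (\<Sum>k. w m (Suc k) * norm (B k) * w k n)"
    using m assms by (intro norm_T)
  also have "\<dots> \<le> K * (\<theta> * w m n)"
    using m assms dominated_nonneg by (intro mult_left_mono suminf_w) auto
  finally show "norm (T Z m) \<le> \<theta> * K * w m n" by (simp add: mult_ac)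
qed

lemma dominated_G: "1 \<le> n \<Longrightarrow> dominated n 1 (\<lambda>m. G m n)"
  by (simp add: dominated_def norm_G)

lemma dominated_add:
  assumes "dominated n K Z" "dominated n L Y"
  shows "dominated n (K + L) (\<lambda>m. Z m + Y m)"
  using assms unfolding dominated_def
  by (auto simp: distrib_right intro!: norm_triangle_mono)

lemma dominated_diff:
  assumes "dominated n K Z" "dominated n L Y"
  shows "dominated n (K + L) (\<lambda>m. Z m - Y m)"
  using assms unfolding dominated_def
  by (auto simp: distrib_right intro!: order_trans[OF norm_triangle_ineq4 add_mono])

lemma dominated_comp:
  assumes "dominated n K Z"
  shows "dominated n (K * norm C) (\<lambda>m. Z m o\<^sub>L C)"
  unfolding dominated_def
proof (intro allI impI)
  fix m :: nat assume m: "1 \<le> m"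
  have "norm (Z m o\<^sub>L C) \<le> norm (Z m) * norm C" by (rule norm_blinfun_compose)
  also have "\<dots> \<le> K * w m n * norm C"
    using assms m unfolding dominated_def by (intro mult_right_mono) auto
  finally show "norm (Z m o\<^sub>L C) \<le> K * norm C * w m n" by (simp add: mult_ac)
qed

lemma dominated_restrict:
  assumes "1 \<le> n" "dominated n K Z"
  shows "dominated n K (\<lambda>k. if p k then Z k else 0)"
  using assms dominated_nonneg[OF assms] w_pos[THEN less_imp_le] unfolding dominated_def
  by (auto intro!: mult_nonneg_nonneg)

lemma dominated_finite_support:
  assumes n: "1 \<le> n"
  shows "\<exists>K. dominated n K (\<lambda>k. if k < (j::nat) then Z k else 0)"
proof (intro exI)
  \<comment> \<open>The sum of finitely many weighted norms serves as an upper bound for their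
    maximum.\<close>
  let ?K = "\<Sum>k\<in>{1..<j}. norm (Z k) / w k n"
  have w: "0 < w k n" if "1 \<le> k" for k using that n by (rule w_pos)
  have q: "0 \<le> norm (Z k) / w k n" if "1 \<le> k" for k
    using w[OF that] by simp
  show "dominated n ?K (\<lambda>k. if k < j then Z k else 0)"
    unfolding dominated_def
  proof (intro allI impI)
    fix k :: nat assume k: "1 \<le> k"
    have "norm (Z k) / w k n \<le> ?K" if "k < j"
      using that k q by (intro member_le_sum) auto
    moreover have "0 \<le> ?K" using q by (intro sum_nonneg) auto
    ultimately show "norm (if k < j then Z k else 0) \<le> ?K * w k n"
      using w[OF k] by (auto simp: divide_le_eq intro!: mult_nonneg_nonneg)
  qed
qed

lemma T_add:
  assumes "1 \<le> m" "1 \<le> n" "dominated n K Z" "dominated n L Y"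
  shows "T (\<lambda>k. Z k + Y k) m = T Z m + T Y m"
  using suminf_add[OF summable_T[OF assms(1-3)] summable_T[OF assms(1,2,4)]]
  by (simp add: T_def blinfun_compose.add_right)

lemma T_diff:
  assumes "1 \<le> m" "1 \<le> n" "dominated n K Z" "dominated n L Y"
  shows "T (\<lambda>k. Z k - Y k) m = T Z m - T Y m"
  using suminf_diff[OF summable_T[OF assms(1-3)] summable_T[OF assms(1,2,4)]]
  by (simp add: T_def blinfun_compose.diff_right)

lemma T_comp:
  assumes "1 \<le> m" "1 \<le> n" "dominated n K Z"
  shows "T (\<lambda>k. Z k o\<^sub>L C) m = T Z m o\<^sub>L C"
  using bounded_linear.suminf[OF blinfun_compose.bounded_linear_left[of C] summable_T[OF assms]]
  by (simp add: T_def blinfun_compose_assoc)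

lemma comp_T:
  assumes "1 \<le> m" "1 \<le> n" "dominated n K Z"
  shows "C o\<^sub>L T Z m = (\<Sum>k. C o\<^sub>L G m (Suc k) o\<^sub>L B k o\<^sub>L Z k)"
  using bounded_linear.suminf[OF blinfun_compose.bounded_linear_right[of C] summable_T[OF assms]]
  by (simp add: T_def blinfun_compose_assoc)

section \<open>Uniqueness and the Neumann series for the perturbed Green function\<close>

lemma dominated_power_T:
  assumes "1 \<le> n" "dominated n K Z"
  shows "dominated n (\<theta> ^ i * K) ((T ^^ i) Z)"
proof (induction i)
  case (Suc i)
  then show ?case using dominated_T[OF assms(1) Suc] by (simp add: mult_ac)
qed (use assms in simp)

text \<open>Replacing \<open>Z\<close> by \<open>T Z\<close> improves the bound by the factor
  \<theta> each time, so the constant \<open>\<theta> ^ i * K\<close> works for every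
  \<open>i\<close> and tends to 0.\<close>

lemma eq_0_of_T_fixed:
  assumes n: "1 \<le> n" and Z: "dominated n K Z" and fixed: "\<And>m. 1 \<le> m \<Longrightarrow> Z m = T Z m"
    and m: "1 \<le> m"
  shows "Z m = 0"
proof -
  have "dominated n (\<theta> ^ i * K) Z" for i
  proof (induction i)
    case (Suc i)
    then show ?case
      using dominated_T[OF n Suc] fixed by (simp add: dominated_def mult_ac)
  qed (use Z in simp)
  then have "norm (Z m) \<le> \<theta> ^ i * K * w m n" for i using m by (simp add: dominated_def)
  moreover have "(\<lambda>i. \<theta> ^ i * K * w m n) \<longlonglongrightarrow> 0 * K * w m n"
    using theta_nonneg theta_less_1 by (intro tendsto_intros LIMSEQ_realpow_zero)
  ultimately have "norm (Z m) \<le> 0 * K * w m n"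
    by (intro LIMSEQ_le_const) auto
  then show ?thesis by simp
qed

text \<open>The Neumann series for the inverse of the identity minus \<open>T\<close>, applied to
  the column \<open>\<lambda>k. G k n\<close>.\<close>

definition H :: "nat \<Rightarrow> nat \<Rightarrow> 'a \<Rightarrow>\<^sub>L 'a" where
  "H m n = (\<Sum>i. (T ^^ i) (\<lambda>k. G k n) m)"

text \<open>The terms decay like \<theta> to the power \<open>i\<close>, so the remainder is a
  geometric tail. \<open>N = 0\<close> bounds \<open>H\<close> itself; large \<open>N\<close> yields
  the fixed-point equation.\<close>

lemma H_remainder:
  assumes n: "1 \<le> n"
  shows "dominated n (\<theta> ^ N / (1 - \<theta>)) (\<lambda>m. H m n - (\<Sum>i<N. (T ^^ i) (\<lambda>k. G k n) m))"
  unfolding dominated_def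
proof (intro allI impI)
  fix m :: nat assume m: "1 \<le> m"
  let ?D = "\<lambda>i. (T ^^ i) (\<lambda>k. G k n) m"
  have D: "norm (?D i) \<le> \<theta> ^ i * w m n" for i
    using dominated_power_T[OF n dominated_G[OF n]] m by (simp add: dominated_def)
  have g: "(\<lambda>i. \<theta> ^ i) sums (1 / (1 - \<theta>))"
    using theta_nonneg theta_less_1 by (intro geometric_sums) auto
  then have g': "summable (\<lambda>i. \<theta> ^ i * w m n)"
    by (intro summable_mult2 sums_summable)
  have s: "summable ?D" using D by (intro summable_comparison_test'[OF g']) auto
  have "norm (H m n - (\<Sum>i<N. ?D i)) = norm (\<Sum>i. ?D (i + N))"
    unfolding H_def using suminf_minus_initial_segment[OF s, of N] by simp
  also have "\<dots> \<le> (\<Sum>i. \<theta> ^ (i + N) * w m n)"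
    using D by (intro norm_suminf_le summable_ignore_initial_segment[OF g'])
  also have "(\<lambda>i. \<theta> ^ (i + N) * w m n) = (\<lambda>i. \<theta> ^ i * (\<theta> ^ N * w m n))"
    by (simp add: power_add mult_ac)
  also have "(\<Sum>i. \<theta> ^ i * (\<theta> ^ N * w m n)) = 1 / (1 - \<theta>) * (\<theta> ^ N * w m n)"
    using g by (intro sums_unique[symmetric] sums_mult2)
  finally show "norm (H m n - (\<Sum>i<N. ?D i)) \<le> \<theta> ^ N / (1 - \<theta>) * w m n" by simp
qed

lemma dominated_H: "1 \<le> n \<Longrightarrow> dominated n (1 / (1 - \<theta>)) (\<lambda>m. H m n)"
  using H_remainder[of n 0] by simp

lemma H_eq:
  assumes m: "1 \<le> m" and n: "1 \<le> n"
  shows "H m n = G m n + T (\<lambda>k. H k n) m"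
proof -
  let ?S = "\<lambda>N m. \<Sum>i<N. (T ^^ i) (\<lambda>k. G k n) m"
  have S: "\<exists>K. dominated n K (?S N)" for N
  proof (induction N)
    case 0
    have "dominated n 0 (?S 0)" by (simp add: dominated_def)
    then show ?case ..
  next
    case (Suc N)
    then obtain K where "dominated n K (?S N)" ..
    from dominated_add[OF this dominated_power_T[OF n dominated_G[OF n]]]
    show ?case by auto
  qed
  have TS: "?S (Suc N) m' = G m' n + T (?S N) m'" if m': "1 \<le> m'" for N m'
  proof (induction N)
    case 0
    show ?case by (simp add: T_def)
  next
    case (Suc N)
    obtain K where K: "dominated n K (?S N)" using S ..
    have "T (?S (Suc N)) m' = T (?S N) m' + (T ^^ Suc N) (\<lambda>k. G k n) m'"
      using T_add[OF m' n K dominated_power_T[OF n dominated_G[OF n]]] by simp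
    then show ?case using Suc by (simp add: add.assoc)
  qed
  let ?R = "\<lambda>N m. H m n - ?S N m"
  let ?E = "H m n - G m n - T (\<lambda>k. H k n) m"
  have bound: "norm ?E \<le> 2 * \<theta> * w m n / (1 - \<theta>) * \<theta> ^ N" for N
  proof -
    obtain K where K: "dominated n K (?S N)" using S ..
    have "T (?R N) m = T (\<lambda>k. H k n) m - T (?S N) m"
      by (rule T_diff[OF m n dominated_H[OF n] K])
    \<comment> \<open>The partial sum of length \<open>Suc N\<close> cancels against
      \<open>G m n + T (?S N) m\<close>. The defect consists of two remainders, each at most
      \<open>\<theta> ^ Suc N / (1 - \<theta>) * w m n\<close>, so \<open>T\<close> never has to be
      exchanged with the series.\<close>
    then have E: "?E = ?R (Suc N) m - T (?R N) m"
      using TS[OF m, of N] by (simp add: algebra_simps)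
    have "norm (?R (Suc N) m) \<le> \<theta> ^ Suc N / (1 - \<theta>) * w m n"
      using H_remainder[OF n, of "Suc N"] m by (simp add: dominated_def)
    moreover have "norm (T (?R N) m) \<le> \<theta> * (\<theta> ^ N / (1 - \<theta>)) * w m n"
      using dominated_T[OF n H_remainder[OF n]] m by (simp add: dominated_def)
    ultimately have "norm ?E \<le> \<theta> ^ Suc N / (1 - \<theta>) * w m n + \<theta> * (\<theta> ^ N / (1 - \<theta>)) * w m n"
      unfolding E by (intro order_trans[OF norm_triangle_ineq4 add_mono])
    then show ?thesis by (simp add: mult_ac)
  qed
  have "(\<lambda>N. 2 * \<theta> * w m n / (1 - \<theta>) * \<theta> ^ N) \<longlonglongrightarrow> 2 * \<theta> * w m n / (1 - \<theta>) * 0"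
    using theta_nonneg theta_less_1 by (intro tendsto_intros LIMSEQ_realpow_zero)
  then have "norm ?E \<le> 2 * \<theta> * w m n / (1 - \<theta>) * 0"
    using bound by (intro LIMSEQ_le_const) auto
  then show ?thesis by (simp add: algebra_simps)
qed

text \<open>The difference of the two sides is a dominated fixed point of \<open>T\<close>, hence
  zero. The product formulas for \<open>H\<close> below are identified in this way.\<close>

lemma eq_H_comp:
  assumes n: "1 \<le> n" and Z: "dominated n K Z"
    and eq: "\<And>m. 1 \<le> m \<Longrightarrow> Z m = (G m n o\<^sub>L C) + T Z m" and m: "1 \<le> m"
  shows "Z m = H m n o\<^sub>L C"
proof -
  note HC = dominated_comp[OF dominated_H[OF n], of C]
  have "Z m - (H m n o\<^sub>L C) = 0"
  proof (rule eq_0_of_T_fixed[OF n dominated_diff[OF Z HC] _ m])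
    fix m :: nat assume m: "1 \<le> m"
    show "Z m - (H m n o\<^sub>L C) = T (\<lambda>m. Z m - (H m n o\<^sub>L C)) m"
      using eq[OF m] H_eq[OF m n]
      by (simp add: T_diff[OF m n Z HC] T_comp[OF m n dominated_H[OF n]] blinfun_compose.add_left)
  qed
  then show ?thesis by simp
qed

section \<open>Recursion and composition identities for \<open>H\<close>\<close>

lemma H_Suc:
  assumes m: "1 \<le> m" and n: "1 \<le> n"
  shows "H (Suc m) n = ((A m + B m) o\<^sub>L H m n) + (if n = Suc m then id_blinfun else 0)"
proof -
  note s = summable_T[OF m n dominated_H[OF n]]
  have s1: "summable (\<lambda>k. A m o\<^sub>L G m (Suc k) o\<^sub>L B k o\<^sub>L H k n)"
    using bounded_linear.summable[OF blinfun_compose.bounded_linear_right[of "A m"] s]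
    by (simp add: blinfun_compose_assoc)
  \<comment> \<open>The jump term of \<open>G_Suc_left\<close> enters the series only at
    \<open>k = m\<close>; it turns \<open>A m\<close> into \<open>A m + B m\<close>.\<close>
  have s2: "(\<lambda>k. if k = m then B k o\<^sub>L H k n else 0) sums (B m o\<^sub>L H m n)"
    using sums_single[of m "\<lambda>k. B k o\<^sub>L H k n"] by simp
  have "G (Suc m) (Suc k) o\<^sub>L B k o\<^sub>L H k n =
      (A m o\<^sub>L G m (Suc k) o\<^sub>L B k o\<^sub>L H k n) + (if k = m then B k o\<^sub>L H k n else 0)" for k
    using m by (auto simp: G_Suc_left intro!: blinfun_eqI simp: blinfun.bilinear_simps)
  then have "T (\<lambda>k. H k n) (Suc m) = (A m o\<^sub>L T (\<lambda>k. H k n) m) + (B m o\<^sub>L H m n)"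
    using suminf_add[OF s1 sums_summable[OF s2]] sums_unique[OF s2]
    by (simp add: T_def[of _ "Suc m"] comp_T[OF m n dominated_H[OF n]])
  then show ?thesis
    using H_eq[OF m n] H_eq[of "Suc m" n] m n
    by (simp add: G_Suc_left blinfun_compose.add_left blinfun_compose.add_right)
qed

lemma H_eq_evol:
  assumes "1 \<le> n" "n \<le> m"
  shows "H m n = evol (\<lambda>k. A k + B k) m n o\<^sub>L H n n"
  using assms(2)
proof (induction m rule: dec_induct)
  case base
  show ?case by simp
next
  case (step m)
  then show ?case using H_Suc[of m n] assms by (simp add: blinfun_compose_assoc)
qed

text \<open>When \<open>G_comp\<close> is applied under the series, its condition
  \<open>Suc k \<le> j\<close> becomes the strict truncation \<open>k < j\<close>.\<close>

lemma G_comp_T: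
  assumes m: "1 \<le> m" and j: "1 \<le> j" and n: "1 \<le> n" and Z: "dominated n K Z"
  shows "G m j o\<^sub>L T Z j = T (\<lambda>k. if k < j then Z k else 0) m - (if m < j then T Z m else 0)"
proof -
  let ?Z = "\<lambda>k. if k < j then Z k else 0"
  have *: "(G m j o\<^sub>L G j (Suc k) o\<^sub>L B k o\<^sub>L Z k) =
      (G m (Suc k) o\<^sub>L B k o\<^sub>L ?Z k) - (if m < j then G m (Suc k) o\<^sub>L B k o\<^sub>L Z k else 0)" for k
    using m j by (auto simp: G_comp intro!: blinfun_eqI simp: blinfun.bilinear_simps)
  show ?thesis
    using suminf_diff[OF summable_T[OF m n dominated_restrict[OF n Z, of "\<lambda>k. k < j"]]
        summable_T[OF m n Z]]
    unfolding comp_T[OF j n Z] * by (auto simp: T_def)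
qed

text \<open>The hypothesis that the quotients of \<open>w\<close> are bounded enters here: the truncation of
  \<open>H m n\<close> to \<open>m \<ge> j\<close> has to be dominated with respect to the weights based at \<open>j\<close>.\<close>

lemma H_comp:
  assumes n: "1 \<le> n" and nj: "n \<le> j" and m: "1 \<le> m"
  shows "H m j o\<^sub>L H j n = (if j \<le> m then H m n else 0)"
proof -
  have j: "1 \<le> j" using n nj by simp
  let ?Z = "\<lambda>m. if j \<le> m then H m n else 0" and ?Y = "\<lambda>m. if m < j then H m n else 0"
  note HZ = dominated_restrict[OF n dominated_H[OF n], of "\<lambda>k. j \<le> k"]
  note HY = dominated_restrict[OF n dominated_H[OF n], of "\<lambda>k. k < j"]
  obtain K where K: "\<And>m. m \<ge> j \<Longrightarrow> w m n \<le> K * w m j"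
    using w_quotient_bounded[OF n nj] by blast
  have "0 \<le> 1 / (1 - \<theta>)" using theta_less_1 by simp
  have "dominated j (1 / (1 - \<theta>) * \<bar>K\<bar>) ?Z"
    unfolding dominated_def
  proof (intro allI impI)
    fix k :: nat assume k: "1 \<le> k"
    have wk: "0 < w k j" using k j by (rule w_pos)
    show "norm (?Z k) \<le> 1 / (1 - \<theta>) * \<bar>K\<bar> * w k j"
    proof (cases "j \<le> k")
      case True
      have "norm (H k n) \<le> 1 / (1 - \<theta>) * w k n"
        using dominated_H[OF n] k by (simp add: dominated_def)
      also have "\<dots> \<le> 1 / (1 - \<theta>) * (\<bar>K\<bar> * w k j)"
        using K[OF True] wk \<open>0 \<le> 1 / (1 - \<theta>)\<close>
        by (intro mult_left_mono order_trans[OF K[OF True] mult_right_mono]) auto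
      finally show ?thesis using True by simp
    qed (use wk \<open>0 \<le> 1 / (1 - \<theta>)\<close> in auto)
  qed
  then have "?Z m = H m j o\<^sub>L H j n"
  proof (rule eq_H_comp[OF j _ _ m])
    fix m :: nat assume m: "1 \<le> m"
    \<comment> \<open>The source term already contains the part of the series below
      \<open>j\<close>, so splitting \<open>T\<close> at \<open>j\<close> leaves exactly the
      equation for the truncation \<open>?Z\<close>.\<close>
    have "G m j o\<^sub>L H j n = (G m j o\<^sub>L G j n) + (G m j o\<^sub>L T (\<lambda>k. H k n) j)"
      by (simp add: H_eq[OF j n] blinfun_compose.add_right)
    also have "\<dots> = G m n + T ?Y m - (if m < j then H m n else 0)"
      using G_comp[OF m j n] nj
      by (simp add: G_comp_T[OF m j n dominated_H[OF n]] H_eq[OF m n])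
    finally have 1: "G m j o\<^sub>L H j n = G m n + T ?Y m - ?Y m" .
    have "(\<lambda>k. ?Y k + ?Z k) = (\<lambda>k. H k n)" by (rule ext) auto
    then have "T (\<lambda>k. H k n) m = T ?Y m + T ?Z m"
      using T_add[OF m n HY HZ] by simp
    then show "?Z m = (G m j o\<^sub>L H j n) + T ?Z m"
      using H_eq[OF m n] unfolding 1 by (auto simp: algebra_simps)
  qed
  then show ?thesis ..
qed

text \<open>Since \<open>G 1 1\<close> kills \<open>Y\<close>, the negative of the perturbed
  solution started at \<open>Y\<close>, cut off to times before \<open>m\<close>, solves the Green
  equation whose source has the solution's value at \<open>m\<close> as right factor. Finite support
  makes it dominated, so uniqueness applies.\<close>

lemma H_comp_evol:
  fixes Y :: "'a \<Rightarrow>\<^sub>L 'a"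
  assumes Y: "G 1 1 o\<^sub>L Y = 0" and m: "1 \<le> m" and k: "1 \<le> k"
  shows "H k m o\<^sub>L evol (\<lambda>k. A k + B k) m 1 o\<^sub>L Y =
    (if k < m then - (evol (\<lambda>k. A k + B k) k 1 o\<^sub>L Y) else 0)"
proof -
  define y where "y = (\<lambda>m. evol (\<lambda>k. A k + B k) m 1 o\<^sub>L Y)"
  have y_Suc: "y (Suc m) = (A m + B m) o\<^sub>L y m" if "1 \<le> m" for m
    using that by (simp add: y_def blinfun_compose_assoc)
  have y1: "y 1 = Y" by (auto simp: y_def intro: blinfun_eqI)
  let ?Z = "\<lambda>m k. if k < m then - y k else 0"
  have T_eq: "T (?Z m) k = (\<Sum>l<m. G k (Suc l) o\<^sub>L B l o\<^sub>L (- y l))" for m k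
    unfolding T_def by (subst suminf_finite[of "{..<m}"]) (auto intro!: sum.cong)
  have eq: "?Z m k = (G k m o\<^sub>L y m) + T (?Z m) k" if m: "1 \<le> m" and k: "1 \<le> k" for m k
    using m
  proof (induction m rule: dec_induct)
    case base
    have "G k 1 o\<^sub>L G 1 1 = G k 1" using k by (simp add: G_comp)
    then have "G k 1 o\<^sub>L Y = 0" using Y by (metis blinfun_compose_assoc blinfun_compose_zero(2))
    moreover have "T (?Z 1) k = 0" by (subst T_eq) simp
    ultimately show ?case using k y1 by simp
  next
    case (step m)
    \<comment> \<open>The series term that is new at \<open>Suc m\<close>, namely
      \<open>l = m\<close>, cancels the contribution of \<open>B m\<close> to
      \<open>y (Suc m)\<close>; the remaining \<open>A m\<close> is absorbed by
      \<open>G_Suc_right\<close>.\<close>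
    have "(G k (Suc m) o\<^sub>L y (Suc m)) - (G k (Suc m) o\<^sub>L B m o\<^sub>L y m) =
        (G k (Suc m) o\<^sub>L A m) o\<^sub>L y m"
      using step y_Suc[of m]
      by (auto intro!: blinfun_eqI simp: blinfun.bilinear_simps)
    also have "\<dots> = (G k m o\<^sub>L y m) - (if k = m then y m else 0)"
      using step k by (auto simp: G_Suc_right intro!: blinfun_eqI simp: blinfun.bilinear_simps)
    finally have "(G k (Suc m) o\<^sub>L y (Suc m)) + T (?Z (Suc m)) k =
        (G k m o\<^sub>L y m) + T (?Z m) k - (if k = m then y m else 0)"
      by (simp add: T_eq blinfun_compose.minus_right algebra_simps)
    also have "\<dots> = ?Z m k - (if k = m then y m else 0)"
      using step.IH by simp
    also have "\<dots> = ?Z (Suc m) k" by auto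
    finally show ?case ..
  qed
  obtain K where K: "dominated m K (?Z m)"
    using dominated_finite_support[OF m, of m "\<lambda>k. - y k"] by blast
  have "?Z m k = H k m o\<^sub>L y m"
    by (rule eq_H_comp[OF m K eq[OF m] k])
  then show ?thesis by (auto simp: y_def blinfun_compose_assoc split: if_splits)
qed

section \<open>The splitting of the perturbed equation\<close>

abbreviation E :: "nat \<Rightarrow> nat \<Rightarrow> 'a \<Rightarrow>\<^sub>L 'a" where
  "E \<equiv> evol (\<lambda>k. A k + B k)"

definition P' :: "nat \<Rightarrow> 'a \<Rightarrow>\<^sub>L 'a" where
  "P' n = H n n"

text \<open>The correction at \<open>m = n\<close> accounts for the jump of the Green function there.\<close>

definition V :: "nat \<Rightarrow> nat \<Rightarrow> 'a \<Rightarrow>\<^sub>L 'a" where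
  "V m n = (if m = n then id_blinfun else 0) - H m n"

text \<open>For \<open>n = Suc m\<close> the identity term in \<open>H_Suc\<close> cancels against
  the diagonal correction of \<open>V\<close>, so the homogeneous recursion persists up to the
  diagonal.\<close>

lemma V_Suc:
  assumes "1 \<le> m" "m < n"
  shows "V (Suc m) n = (A m + B m) o\<^sub>L V m n"
  using assms H_Suc[of m n] by (auto simp: V_def blinfun_compose.minus_right)

lemma E_comp_V:
  assumes "1 \<le> m" "m \<le> n"
  shows "E n m o\<^sub>L V m n = V n n"
  using assms(2,1)
proof (induction m rule: inc_induct)
  case (step m)
  have "E n m = E n (Suc m) o\<^sub>L E (Suc m) m"
    using step by (intro evol_comp[symmetric]) auto
  then show ?case using step V_Suc[of m n] by (simp add: blinfun_compose_assoc)
qed simp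

text \<open>With \<open>j = 1\<close> the truncated series in \<open>G_comp_T\<close> retains only
  \<open>k = 0\<close>, where \<open>B\<close> vanishes. Hence backward transport to time 1 lands in
  the unperturbed kernel.\<close>

lemma G_1_V:
  assumes n: "1 \<le> n"
  shows "G 1 1 o\<^sub>L V 1 n = 0"
proof -
  have "T (\<lambda>k. if k < 1 then H k n else 0) 1 = T (\<lambda>k. 0) 1"
    unfolding T_def by (intro suminf_cong) auto
  then have "G 1 1 o\<^sub>L T (\<lambda>k. H k n) 1 = 0"
    using G_comp_T[of 1 1 n, OF _ _ n dominated_H[OF n]] by (simp add: T_def)
  then have "G 1 1 o\<^sub>L H 1 n = G 1 1 o\<^sub>L G 1 n"
    using H_eq[of 1 n] n by (simp add: blinfun_compose.add_right)
  moreover have "G 1 1 o\<^sub>L G 1 n = (if n = 1 then G 1 1 else 0)"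
    using G_comp[of 1 1 n] n by auto
  ultimately show ?thesis
    by (simp add: V_def blinfun_compose.diff_right)
qed

lemma P'_idem: "1 \<le> n \<Longrightarrow> P' n o\<^sub>L P' n = P' n"
  by (simp add: P'_def H_comp)

lemma V_apply_E:
  assumes x: "x \<in> ker (G 1 1)" and "1 \<le> k" "k \<le> m"
  shows "blinfun_apply (V k m) (blinfun_apply (E m 1) x) = blinfun_apply (E k 1) x"
proof -
  \<comment> \<open>The complementary projection serves as \<open>Y\<close>: \<open>G 1 1\<close>
    annihilates it, and it fixes every vector of \<open>ker (G 1 1)\<close>.\<close>
  have "G 1 1 o\<^sub>L (id_blinfun - G 1 1) = 0"
    using G_comp[of 1 1 1] by (simp add: blinfun_compose.diff_right)
  from H_comp_evol[OF this, of m k] assms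
  have "H k m o\<^sub>L E m 1 o\<^sub>L (id_blinfun - G 1 1) =
      (if k < m then - (E k 1 o\<^sub>L (id_blinfun - G 1 1)) else 0)" by simp
  from arg_cong[OF this, of "\<lambda>X. blinfun_apply X x"] assms show ?thesis
    by (auto simp: V_def ker_def blinfun.bilinear_simps split: if_splits)
qed

text \<open>The fixed vectors of \<open>V m m\<close> form \<open>ker (P' m)\<close>, and
  \<open>V m m\<close> factors as \<open>V 1 m\<close> followed by \<open>E m 1\<close>. All
  perturbed kernels thus come from one initial space, which reduces their invariance to the cocycle
  property of \<open>E\<close>.\<close>

lemma ker_P':
  assumes m: "1 \<le> m"
  shows "ker (P' m) = blinfun_apply (E m 1) ` ker (G 1 1)"
proof (intro equalityI subsetI)
  fix y assume "y \<in> ker (P' m)"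
  then have "y = blinfun_apply (V m m) y"
    by (simp add: ker_def P'_def V_def blinfun.bilinear_simps)
  also have "\<dots> = blinfun_apply (E m 1) (blinfun_apply (V 1 m) y)"
    using E_comp_V[of 1 m] m by (metis blinfun_apply_blinfun_compose order_refl)
  finally have "y = blinfun_apply (E m 1) (blinfun_apply (V 1 m) y)" .
  moreover have "blinfun_apply (V 1 m) y \<in> ker (G 1 1)"
    using arg_cong[OF G_1_V[OF m], of "\<lambda>X. blinfun_apply X y"] by (simp add: ker_def)
  ultimately show "y \<in> blinfun_apply (E m 1) ` ker (G 1 1)" by blast
next
  fix y assume "y \<in> blinfun_apply (E m 1) ` ker (G 1 1)"
  then obtain x where x: "x \<in> ker (G 1 1)" "y = blinfun_apply (E m 1) x" by blast
  from V_apply_E[OF x(1) m order_refl] x(2) show "y \<in> ker (P' m)"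
    by (simp add: ker_def P'_def V_def blinfun.bilinear_simps)
qed

lemma E_ker_P':
  assumes n: "1 \<le> n" and nm: "n \<le> m"
  shows "blinfun_apply (E m n) ` ker (P' n) = ker (P' m)"
  using assms by (simp add: ker_P' image_image evol_apply_evol)

lemma V_E_ker_P':
  assumes n: "1 \<le> n" and nm: "n \<le> m" and z: "z \<in> ker (P' n)"
  shows "blinfun_apply (V n m) (blinfun_apply (E m n) z) = z"
proof -
  obtain x where "x \<in> ker (G 1 1)" "z = blinfun_apply (E n 1) x"
    using z ker_P'[OF n] by auto
  with n nm show ?thesis by (simp add: evol_apply_evol V_apply_E[unfolded One_nat_def])
qed

lemma bij_E_ker_P':
  assumes "1 \<le> n" "n \<le> m"
  shows "bij_betw (blinfun_apply (E m n)) (ker (P' n)) (ker (P' m))"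
  unfolding bij_betw_def
  using V_E_ker_P'[OF assms] E_ker_P'[OF assms] by (auto intro: inj_on_inverseI)

lemma evol_back_P':
  assumes n: "1 \<le> n" and nm: "n \<le> m" and y: "y \<in> ker (P' m)"
  shows "evol_back (\<lambda>k. A k + B k) P' n m y = blinfun_apply (V n m) y"
proof -
  obtain z where z: "z \<in> ker (P' n)" "y = blinfun_apply (E m n) z"
    using y E_ker_P'[OF n nm] by auto
  then show ?thesis
    using bij_betw_inv_into_left[OF bij_E_ker_P'[OF n nm] z(1)] V_E_ker_P'[OF n nm z(1)]
    by (simp add: evol_back_def)
qed

text \<open>A vector splits into its \<open>P' n\<close> part, on which \<open>H_comp\<close> gives
  the identity, and a part in \<open>ker (P' n)\<close>, which \<open>E m n\<close> carries into
  \<open>ker (P' m)\<close>.\<close>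

lemma P'_comp_E:
  assumes n: "1 \<le> n" and nm: "n \<le> m"
  shows "P' m o\<^sub>L E m n = E m n o\<^sub>L P' n"
proof (rule blinfun_eqI)
  fix x
  let ?y = "x - blinfun_apply (P' n) x"
  have m: "1 \<le> m" using n nm by simp
  have "?y \<in> ker (P' n)"
    using arg_cong[OF P'_idem[OF n], of "\<lambda>X. blinfun_apply X x"]
    by (simp add: ker_def blinfun.bilinear_simps)
  then have 0: "blinfun_apply (P' m) (blinfun_apply (E m n) ?y) = 0"
    using E_ker_P'[OF n nm] by (auto simp: ker_def)
  have "P' m o\<^sub>L E m n o\<^sub>L P' n = E m n o\<^sub>L P' n"
    using H_comp[OF n nm m] H_eq_evol[OF n nm] by (simp add: P'_def blinfun_compose_assoc)
  from arg_cong[OF this, of "\<lambda>X. blinfun_apply X x"] 0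
  show "blinfun_apply (P' m o\<^sub>L E m n) x = blinfun_apply (E m n o\<^sub>L P' n) x"
    by (simp add: blinfun.bilinear_simps)
qed

lemma invariant_splitting_P': "invariant_splitting (\<lambda>k. A k + B k) P'"
proof -
  have "\<exists>C. \<forall>y\<in>ker (P' m). norm (evol_back (\<lambda>k. A k + B k) P' n m y) \<le> C * norm y"
    if "1 \<le> n" "n \<le> m" for m n
    using that by (auto simp: evol_back_P' intro!: exI[of _ "norm (V n m)"] norm_blinfun)
  then show ?thesis
    by (auto simp: invariant_splitting_def idx_ge_def P'_idem P'_comp_E E_ker_P' bij_E_ker_P'
        simp del: One_nat_def)
qed

section \<open>Norm bounds for the perturbed dichotomy\<close>

lemma norm_H: "\<lbrakk>1 \<le> m; 1 \<le> n\<rbrakk> \<Longrightarrow> norm (H m n) \<le> 1 / (1 - \<theta>) * w m n"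
  using dominated_H[of n] by (simp add: dominated_def)

lemma norm_E_P':
  assumes "1 \<le> n" "n \<le> m"
  shows "norm (E m n o\<^sub>L P' n) \<le> 1 / (1 - \<theta>) * w m n"
  using norm_H[of m n] H_eq_evol[OF assms] assms by (simp add: P'_def)

lemma V_comp_P':
  assumes "1 \<le> m" "m \<le> n"
  shows "V m n o\<^sub>L P' n = 0"
  using assms H_comp[of n n m] by (auto simp: V_def P'_def blinfun_compose.diff_left)

text \<open>On \<open>ker (P' n)\<close> the backward evolution is \<open>V m n\<close>, and
  \<open>V m n\<close> vanishes on the range of \<open>P' n\<close>, so the complementary projection
  is absorbed.\<close>

lemma onorm_evol_back_P':
  assumes m: "1 \<le> m" and mn: "m \<le> n"
  shows "onorm (\<lambda>x. evol_back (\<lambda>k. A k + B k) P' m n (blinfun_apply (id_blinfun - P' n) x)) =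
      norm (V m n)"
proof -
  have n: "1 \<le> n" using m mn by simp
  have "evol_back (\<lambda>k. A k + B k) P' m n (blinfun_apply (id_blinfun - P' n) x) =
      blinfun_apply (V m n) x" for x
  proof -
    have "blinfun_apply (id_blinfun - P' n) x \<in> ker (P' n)"
      using arg_cong[OF P'_idem[OF n], of "\<lambda>X. blinfun_apply X x"]
      by (simp add: ker_def blinfun.bilinear_simps)
    moreover have "blinfun_apply (V m n) (blinfun_apply (P' n) x) = 0"
      using arg_cong[OF V_comp_P'[OF m mn], of "\<lambda>X. blinfun_apply X x"] by simp
    ultimately show ?thesis
      using evol_back_P'[OF m mn] by (simp add: blinfun.bilinear_simps)
  qed
  then show ?thesis by (simp add: norm_blinfun.rep_eq)
qed

text \<open>Here the identity and the series are estimated separately, both in terms of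
  \<open>c n\<close>: the total is \<open>c n + \<theta> / (1 - \<theta>) * c n\<close>, which is
  \<open>c n / (1 - \<theta>)\<close>.\<close>

lemma norm_V_diag:
  assumes n: "1 \<le> n"
  shows "norm (V n n) \<le> 1 / (1 - \<theta>) * c n"
proof -
  have "V n n = (id_blinfun - G n n) - T (\<lambda>k. H k n) n"
    using H_eq[OF n n] by (simp add: V_def)
  then have "norm (V n n) \<le> norm (id_blinfun - G n n) + norm (T (\<lambda>k. H k n) n)"
    by (simp add: norm_triangle_ineq4)
  also have "\<dots> \<le> c n + 1 / (1 - \<theta>) * (\<theta> * c n)"
    using theta_less_1
    by (intro add_mono norm_id_minus_G[OF n] order_trans[OF norm_T[OF n n dominated_H[OF n]]]
        mult_left_mono suminf_w_diag[OF n]) auto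
  also have "\<dots> = 1 / (1 - \<theta>) * c n"
    using theta_less_1 by (simp add: field_simps)
  finally show ?thesis .
qed

theorem general_dichotomy_perturbed:
  "general_dichotomy (\<lambda>k. A k + B k) (\<lambda>m n. 1 / (1 - \<theta>) * w m n)
    (\<lambda>m n. 1 / (1 - \<theta>) * (if m = n then c n else w m n))"
  unfolding general_dichotomy_def
proof (intro exI[of _ P'] conjI ballI)
  show "invariant_splitting (\<lambda>k. A k + B k) P'" by (rule invariant_splitting_P')
next
  fix p :: "nat \<times> nat" assume "p \<in> idx_ge"
  then show "case p of (m, n) \<Rightarrow> norm (E m n o\<^sub>L P' n) \<le> 1 / (1 - \<theta>) * w m n"
    using norm_E_P' by (auto simp: idx_ge_def)
next
  fix p :: "nat \<times> nat" assume "p \<in> idx_le"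
  then obtain m n where p: "p = (m, n)" and mn: "1 \<le> m" "m \<le> n"
    by (auto simp: idx_le_def)
  have "norm (V m n) \<le> 1 / (1 - \<theta>) * (if m = n then c n else w m n)"
    using norm_V_diag[of n] norm_H[of m n] mn by (auto simp: V_def)
  then show "case p of (m, n) \<Rightarrow>
      onorm (\<lambda>x. evol_back (\<lambda>k. A k + B k) P' m n (blinfun_apply (id_blinfun - P' n) x))
        \<le> 1 / (1 - \<theta>) * (if m = n then c n else w m n)"
    by (simp add: p onorm_evol_back_P'[OF mn])
qed

end

section \<open>The Green function of a dichotomy\<close>

text \<open>\<open>Blinfun\<close> returns the intended operator once the function is bounded
  linear, which \<open>bounded_linear_evol_back\<close> provides for an invariant splitting and
  indices in \<open>idx_le\<close>.\<close>

definition evol_ker ::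
    "(nat \<Rightarrow> 'a::real_normed_vector \<Rightarrow>\<^sub>L 'a) \<Rightarrow> (nat \<Rightarrow> 'a \<Rightarrow>\<^sub>L 'a) \<Rightarrow> nat \<Rightarrow> nat \<Rightarrow> 'a \<Rightarrow>\<^sub>L 'a" where
  "evol_ker A P m n = Blinfun (\<lambda>x. evol_back A P m n (blinfun_apply (id_blinfun - P n) x))"

definition green ::
    "(nat \<Rightarrow> 'a::real_normed_vector \<Rightarrow>\<^sub>L 'a) \<Rightarrow> (nat \<Rightarrow> 'a \<Rightarrow>\<^sub>L 'a) \<Rightarrow> nat \<Rightarrow> nat \<Rightarrow> 'a \<Rightarrow>\<^sub>L 'a" where
  "green A P m n = (if n \<le> m then evol A m n o\<^sub>L P n else - evol_ker A P m n)"

context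
  fixes A P :: "nat \<Rightarrow> 'a::real_normed_vector \<Rightarrow>\<^sub>L 'a"
  assumes S: "invariant_splitting A P"
begin

section \<open>Backward evolution along the kernels\<close>

lemma proj_idem: "1 \<le> n \<Longrightarrow> blinfun_apply (P n) (blinfun_apply (P n) x) = blinfun_apply (P n) x"
  using S by (metis invariant_splitting_def blinfun_apply_blinfun_compose)

lemma proj_evol:
  assumes "1 \<le> n" "n \<le> m"
  shows "blinfun_apply (P m) (blinfun_apply (evol A m n) x) =
      blinfun_apply (evol A m n) (blinfun_apply (P n) x)"
proof -
  have "P m o\<^sub>L evol A m n = evol A m n o\<^sub>L P n"
    using S assms by (auto simp: invariant_splitting_def idx_ge_def)
  from arg_cong[OF this, of "\<lambda>X. blinfun_apply X x"] show ?thesis by simp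
qed

lemma proj_step:
  assumes "1 \<le> n"
  shows "blinfun_apply (P (Suc n)) (blinfun_apply (A n) x) =
      blinfun_apply (A n) (blinfun_apply (P n) x)"
  using proj_evol[of n "Suc n"] assms by simp

lemma bij_evol:
  assumes "1 \<le> m" "m \<le> n"
  shows "bij_betw (blinfun_apply (evol A n m)) (ker (P m)) (ker (P n))"
  using S assms by (auto simp: invariant_splitting_def idx_ge_def)

lemma evol_ker_apply:
  assumes "1 \<le> m" "m \<le> n"
  shows "blinfun_apply (evol_ker A P m n) x = evol_back A P m n (x - blinfun_apply (P n) x)"
  using bounded_linear_evol_back[OF S, of m n] assms
  by (simp add: evol_ker_def idx_le_def bounded_linear_Blinfun_apply blinfun.diff_left)

lemma norm_evol_ker:
  assumes "1 \<le> m" "m \<le> n"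
  shows "norm (evol_ker A P m n) =
    onorm (\<lambda>x. evol_back A P m n (blinfun_apply (id_blinfun - P n) x))"
  using bounded_linear_evol_back[OF S, of m n] assms
  by (simp add: evol_ker_def idx_le_def bounded_linear_Blinfun_apply norm_blinfun.rep_eq)

lemma comp_proj_in_ker: "1 \<le> n \<Longrightarrow> x - blinfun_apply (P n) x \<in> ker (P n)"
  by (simp add: ker_def blinfun.diff_right proj_idem)

lemma proj_evol_ker:
  assumes "1 \<le> m" "m \<le> n"
  shows "blinfun_apply (P m) (blinfun_apply (evol_ker A P m n) x) = 0"
  using bij_betw_apply[OF bij_betw_inv_into[OF bij_evol[OF assms]] comp_proj_in_ker[of n x]] assms
  by (simp add: evol_ker_apply evol_back_def ker_def)

lemma evol_evol_ker:
  assumes "1 \<le> m" "m \<le> n"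
  shows "blinfun_apply (evol A n m) (blinfun_apply (evol_ker A P m n) x) =
      x - blinfun_apply (P n) x"
  using bij_betw_inv_into_right[OF bij_evol[OF assms] comp_proj_in_ker[of n x]] assms
  by (simp add: evol_ker_apply evol_back_def)

text \<open>Forward evolution is injective on \<open>ker (P m)\<close>, so a vector there is
  determined by its forward image. This reduces identities for \<open>evol_ker\<close> to forward
  ones.\<close>

lemma evol_ker_eqI:
  assumes "1 \<le> m" "m \<le> n" "blinfun_apply (P m) x = 0"
    and "blinfun_apply (evol A n m) x = y - blinfun_apply (P n) y"
  shows "blinfun_apply (evol_ker A P m n) y = x"
  using bij_betw_inv_into_left[OF bij_evol[OF assms(1,2)], of x] assms
  by (simp add: evol_ker_apply evol_back_def ker_def)

lemma evol_ker_same: "1 \<le> n \<Longrightarrow> evol_ker A P n n = id_blinfun - P n"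
  by (auto intro!: blinfun_eqI evol_ker_eqI simp: blinfun.bilinear_simps proj_idem)

lemma evol_ker_evol:
  assumes "1 \<le> m" "m \<le> j" "j \<le> n"
  shows "blinfun_apply (evol_ker A P m n) (blinfun_apply (evol A n j) x) =
      blinfun_apply (evol_ker A P m j) x"
proof (rule evol_ker_eqI)
  have "blinfun_apply (evol A n m) (blinfun_apply (evol_ker A P m j) x) =
      blinfun_apply (evol A n j) (blinfun_apply (evol A j m) (blinfun_apply (evol_ker A P m j) x))"
    using assms by (simp add: evol_apply_evol)
  also have "\<dots> = blinfun_apply (evol A n j) x - blinfun_apply (P n) (blinfun_apply (evol A n j) x)"
    using assms by (simp add: evol_evol_ker proj_evol blinfun.diff_right)
  finally show "blinfun_apply (evol A n m) (blinfun_apply (evol_ker A P m j) x) = \<dots>" .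
qed (use assms proj_evol_ker in auto)

lemma evol_evol_ker_comp:
  assumes "1 \<le> m" "m \<le> j" "j \<le> n"
  shows "blinfun_apply (evol A j m) (blinfun_apply (evol_ker A P m n) x) =
      blinfun_apply (evol_ker A P j n) x"
proof (rule evol_ker_eqI[symmetric])
  show "blinfun_apply (P j) (blinfun_apply (evol A j m) (blinfun_apply (evol_ker A P m n) x)) = 0"
    using assms by (simp add: proj_evol proj_evol_ker)
  show "blinfun_apply (evol A n j) (blinfun_apply (evol A j m) (blinfun_apply (evol_ker A P m n) x))
      = x - blinfun_apply (P n) x"
    using assms by (simp add: evol_apply_evol evol_evol_ker)
qed (use assms in auto)

lemma evol_ker_proj:
  assumes "1 \<le> m" "m \<le> n"
  shows "blinfun_apply (evol_ker A P m n) (blinfun_apply (P n) x) = 0"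
  using assms by (intro evol_ker_eqI) (auto simp: proj_idem)

lemma evol_ker_evol_ker:
  assumes "1 \<le> m" "m \<le> j" "j \<le> n"
  shows "blinfun_apply (evol_ker A P m j) (blinfun_apply (evol_ker A P j n) x) =
      blinfun_apply (evol_ker A P m n) x"
  using assms by (intro evol_ker_eqI) (auto simp: proj_evol_ker evol_evol_ker_comp)

section \<open>Recursion and composition of the unperturbed Green function\<close>

lemma green_Suc_left:
  assumes "1 \<le> m" "1 \<le> n"
  shows "green A P (Suc m) n = (A m o\<^sub>L green A P m n) + (if n = Suc m then id_blinfun else 0)"
proof (rule blinfun_eqI)
  fix x
  consider "n \<le> m" | "n = Suc m" | "Suc m < n" by linarith
  then show "blinfun_apply (green A P (Suc m) n) x =
      blinfun_apply ((A m o\<^sub>L green A P m n) + (if n = Suc m then id_blinfun else 0)) x"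
  proof cases
    \<comment> \<open>The formula for \<open>green\<close> changes branch here: the diagonal belongs
      to the stable branch, and the two branches differ by the identity.\<close>
    case 2
    then show ?thesis
      using assms evol_evol_ker[of m "Suc m" x] by (simp add: green_def blinfun.bilinear_simps)
  next
    case 3
    then show ?thesis
      using assms evol_evol_ker_comp[of m "Suc m" n x] by (simp add: green_def blinfun.bilinear_simps)
  qed (simp add: green_def)
qed

lemma green_Suc_right:
  assumes "1 \<le> m" "1 \<le> n"
  shows "green A P m (Suc n) o\<^sub>L A n = green A P m n - (if m = n then id_blinfun else 0)"
proof (rule blinfun_eqI)
  fix x
  consider "n < m" | "n = m" | "m < n" by linarith
  then show "blinfun_apply (green A P m (Suc n) o\<^sub>L A n) x =
      blinfun_apply (green A P m n - (if m = n then id_blinfun else 0)) x"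
  proof cases
    case 1
    have "blinfun_apply (evol A m (Suc n)) (blinfun_apply (A n) y) =
        blinfun_apply (evol A m n) y" for y
      using 1 evol_apply_evol[of n "Suc n" m A y] by simp
    with 1 assms show ?thesis by (simp add: green_def blinfun.bilinear_simps proj_step)
  next
    case 2
    then show ?thesis
      using assms evol_ker_evol[of m m "Suc m" x] evol_ker_same[of m]
      by (simp add: green_def blinfun.bilinear_simps)
  next
    case 3
    then show ?thesis
      using assms evol_ker_evol[of m n "Suc n" x] by (simp add: green_def blinfun.bilinear_simps)
  qed
qed

text \<open>One formula covers four cases: stable with stable and unstable with unstable follow the
  cocycle rule, up to sign, while the mixed products vanish.\<close>

lemma green_comp:
  assumes "1 \<le> m" "1 \<le> j" "1 \<le> k"
  shows "green A P m j o\<^sub>L green A P j k =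
    (if k \<le> j then green A P m k else 0) - (if m < j then green A P m k else 0)"
proof (rule blinfun_eqI)
  fix x
  have 1: "blinfun_apply (evol_ker A P m j) (blinfun_apply (evol A j k) (blinfun_apply (P k) x)) =
      0"
    if "m \<le> j" "k \<le> j"
    using that assms evol_ker_proj[of m j] by (simp flip: proj_evol)
  show "blinfun_apply (green A P m j o\<^sub>L green A P j k) x =
    blinfun_apply ((if k \<le> j then green A P m k else 0) - (if m < j then green A P m k else 0)) x"
    using assms 1
    by (auto simp: green_def blinfun.bilinear_simps proj_evol proj_idem proj_evol_ker evol_ker_evol_ker
        evol_apply_evol)
qed

end

section \<open>Robustness\<close>

lemma evol_cong:
  "1 \<le> n \<Longrightarrow> (\<And>k. 1 \<le> k \<Longrightarrow> A k = A' k) \<Longrightarrow> evol A m n = evol A' m n"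
  by (induction m) auto

text \<open>Allows \<open>B\<close> to be changed at index 0 and the bounds to be changed off their
  index sets.\<close>

lemma general_dichotomy_cong:
  assumes A: "\<And>k. 1 \<le> k \<Longrightarrow> A k = A' k" and "general_dichotomy A a b"
    and a: "\<And>m n. 1 \<le> n \<Longrightarrow> n \<le> m \<Longrightarrow> a m n = a' m n"
    and b: "\<And>m n. 1 \<le> m \<Longrightarrow> m \<le> n \<Longrightarrow> b m n = b' m n"
  shows "general_dichotomy A' a' b'"
proof -
  have E: "evol A m n = evol A' m n" if "1 \<le> n" for m n
    using evol_cong[of n A A'] A that by blast
  have EB: "evol_back A P m n = evol_back A' P m n" if "1 \<le> m" for P m n
    using E[OF that] by (simp add: evol_back_def)
  obtain P where P: "invariant_splitting A P"
    "\<forall>(m, n) \<in> idx_ge. norm (evol A m n o\<^sub>L P n) \<le> a m n"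
    "\<forall>(m, n) \<in> idx_le. onorm (\<lambda>x. evol_back A P m n (blinfun_apply (id_blinfun - P n) x)) \<le> b m n"
    using assms(2) by (auto simp: general_dichotomy_def)
  have "invariant_splitting A' P"
    using P(1) E EB by (auto simp: invariant_splitting_def idx_ge_def)
  then show ?thesis
    using P(2,3) a b E EB unfolding general_dichotomy_def
    by (intro exI[of _ P]) (auto simp: idx_ge_def idx_le_def)
qed

text \<open>Matches one series over all \<open>k\<close> with the three sums of
  \<open>lambda'\<close> and \<open>mu'\<close>, which start at \<open>k = 1\<close>.\<close>

lemma suminf_split_three:
  fixes f :: "nat \<Rightarrow> ennreal"
  assumes "1 \<le> i" "i \<le> j" "f 0 = 0"
  shows "(\<Sum>k. f k) = sum f {1..<i} + sum f {i..<j} + (\<Sum>k. f (j + k))"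
proof -
  have "{..<j} = {0} \<union> {1..<i} \<union> {i..<j}" using assms by auto
  then have "sum f {..<j} = sum f {1..<i} + sum f {i..<j}"
    using assms by (simp add: sum.union_disjoint ivl_disj_int)
  moreover have "(\<Sum>k. f k) = (\<Sum>k. f (k + j)) + sum f {..<j}"
    by (rule suminf_offset) simp
  ultimately show ?thesis by (simp add: add.commute)
qed

lemma summable_suminf_leI:
  fixes f :: "nat \<Rightarrow> real"
  assumes "\<And>k. 0 \<le> f k" "(\<Sum>k. ennreal (f k)) \<le> ennreal x" "0 \<le> x"
  shows "summable f" "(\<Sum>k. f k) \<le> x"
proof -
  have *: "(\<Sum>k. ennreal (f k)) \<noteq> top" using assms(2) by (auto simp: top_unique)
  then show "summable f" using assms(1) by (intro summable_suminf_not_top)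
  show "(\<Sum>k. f k) \<le> x" using suminf_ennreal[OF assms(1) *] assms(2,3) by simp
qed

lemma le_mult_of_divide_le_ennreal:
  fixes x \<theta> :: ennreal
  assumes "x / ennreal r \<le> \<theta>" "0 < r" "\<theta> < top"
  shows "x \<le> ennreal (enn2real \<theta> * r)"
proof -
  have "x = x / ennreal r * ennreal r"
    using assms(2) by (simp add: ennreal_divide_times mult_divide_eq_ennreal)
  also have "\<dots> \<le> \<theta> * ennreal r" using assms(1) by (rule mult_right_mono) simp
  also have "\<dots> = ennreal (enn2real \<theta> * r)" using assms by (simp add: ennreal_mult)
  finally show ?thesis .
qed

theorem theorem5:
  fixes A B :: "nat \<Rightarrow> 'a::banach \<Rightarrow>\<^sub>L 'a"
    and a b :: "nat \<Rightarrow> nat \<Rightarrow> real"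
    and \<theta> :: ennreal and \<sigma> :: real
  assumes a_pos: "\<forall>(m, n) \<in> idx_ge. 0 < a m n"
    and b_pos: "\<forall>(m, n) \<in> idx_le. 0 < b m n"
    and dichotomy: "general_dichotomy A a b"
    and sup_finite: "\<forall>(j, n) \<in> idx_ge. (SUP m\<in>{j..}. ennreal (a m n / a m j)) < \<infinity>"
    and theta_eq: "\<theta> = max (SUP (m, n)\<in>idx_ge. lambda' a b B m n / ennreal (a m n))
                          (SUP (m, n)\<in>idx_le. mu' a b B m n / ennreal (b m n))"
    and theta_less: "\<theta> < 1"
    and sigma_eq: "\<sigma> = 1 / (1 - enn2real \<theta>)"
  shows "general_dichotomy (\<lambda>n. A n + B n) (\<lambda>m n. \<sigma> * a m n) (\<lambda>m n. \<sigma> * b m n)"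
proof -
  obtain P where S: "invariant_splitting A P"
    and D1: "\<And>m n. 1 \<le> n \<Longrightarrow> n \<le> m \<Longrightarrow> norm (evol A m n o\<^sub>L P n) \<le> a m n"
    and D2: "\<And>m n. 1 \<le> m \<Longrightarrow> m \<le> n \<Longrightarrow> norm (evol_ker A P m n) \<le> b m n"
    using dichotomy
    by (fastforce simp: general_dichotomy_def idx_ge_def idx_le_def norm_evol_ker)
  let ?B = "B(0 := 0)" and ?\<theta> = "enn2real \<theta>"
  \<comment> \<open>A single weight for both branches of the Green function; the diagonal value is
    \<open>a n n\<close>, and \<open>b n n\<close> is passed separately as
    \<open>c n\<close>.\<close>
  define w where "w m n = (if n \<le> m then a m n else b m n)" for m n
  have ap: "0 < a m n" if "1 \<le> n" "n \<le> m" for m n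
    using a_pos that by (auto simp: idx_ge_def)
  have bp: "0 < b m n" if "1 \<le> m" "m \<le> n" for m n
    using b_pos that by (auto simp: idx_le_def)
  have w_pos: "0 < w m n" if "1 \<le> m" "1 \<le> n" for m n
    using that ap bp by (simp add: w_def)
  have theta_top: "\<theta> < top" using theta_less by (metis ennreal_one_less_top less_trans)
  have theta_1: "?\<theta> < 1"
    using theta_less theta_top by (metis enn2real_1 enn2real_less_iff ennreal_1 zero_less_one)
  have lambda'_le: "lambda' a b B m n \<le> ennreal (?\<theta> * a m n)" if "1 \<le> n" "n \<le> m" for m n
  proof (rule le_mult_of_divide_le_ennreal[OF _ ap[OF that] theta_top])
    have "(case (m, n) of (m, n) \<Rightarrow> lambda' a b B m n / ennreal (a m n)) \<le> \<theta>"
      unfolding theta_eq using that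
      by (intro order_trans[OF SUP_upper max.cobounded1]) (auto simp: idx_ge_def)
    then show "lambda' a b B m n / ennreal (a m n) \<le> \<theta>" by simp
  qed
  have mu'_le: "mu' a b B m n \<le> ennreal (?\<theta> * b m n)" if "1 \<le> m" "m \<le> n" for m n
  proof (rule le_mult_of_divide_le_ennreal[OF _ bp[OF that] theta_top])
    have "(case (m, n) of (m, n) \<Rightarrow> mu' a b B m n / ennreal (b m n)) \<le> \<theta>"
      unfolding theta_eq using that
      by (intro order_trans[OF SUP_upper max.cobounded2]) (auto simp: idx_le_def)
    then show "mu' a b B m n / ennreal (b m n) \<le> \<theta>" by simp
  qed
  let ?f = "\<lambda>m n k. w m (Suc k) * norm (?B k) * w k n"
  have f_nonneg: "0 \<le> ?f m n k" if "1 \<le> m" "1 \<le> n" for m n k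
    using that w_pos[of m "Suc k"] w_pos[of k n] by (cases "k = 0") auto
  \<comment> \<open>\<open>w m (Suc k)\<close> changes from \<open>a\<close> to \<open>b\<close> at
    \<open>k = m\<close>, and \<open>w k n\<close> from \<open>b\<close> to \<open>a\<close> at
    \<open>k = n\<close>. These are the cut points of the three sums.\<close>
  have lambda'_eq: "(\<Sum>k. ennreal (?f m n k)) = lambda' a b B m n" if "1 \<le> n" "n \<le> m" for m n
    unfolding lambda'_def using that
    by (subst suminf_split_three[of n m])
      (auto simp: w_def intro!: arg_cong2[where f = "(+)"] sum.cong suminf_cong)
  have mu'_eq: "(\<Sum>k. ennreal (?f m n k)) = mu' a b B m n" if "1 \<le> m" "m \<le> n" for m n
    unfolding mu'_def using that
    by (subst suminf_split_three[of m n])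
      (auto simp: w_def intro!: arg_cong2[where f = "(+)"] sum.cong suminf_cong)
  have sum_le: "(\<Sum>k. ennreal (?f m n k)) \<le> ennreal (?\<theta> * w m n)" if "1 \<le> m" "1 \<le> n" for m n
    using that lambda'_eq lambda'_le mu'_eq mu'_le by (simp add: w_def)
  have theta_w: "0 \<le> ?\<theta> * w m n" if "1 \<le> m" "1 \<le> n" for m n
    using w_pos[OF that] by simp
  have "perturbed_green A ?B (green A P) w (\<lambda>n. b n n) ?\<theta>"
  proof (rule perturbed_green.intro)
    fix m n :: nat assume mn: "1 \<le> m" "1 \<le> n"
    show "0 < w m n" using mn by (rule w_pos)
    show "norm (green A P m n) \<le> w m n"
      using mn D1 D2 by (simp add: green_def w_def)
    note s = summable_suminf_leI[OF f_nonneg[OF mn] sum_le[OF mn] theta_w[OF mn]]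
    show "summable (?f m n)" "(\<Sum>k. ?f m n k) \<le> ?\<theta> * w m n" by (rule s)+
  next
    fix n :: nat assume n: "1 \<le> n"
    show "norm (id_blinfun - green A P n n) \<le> b n n"
      using D2[OF n order_refl] by (simp add: green_def evol_ker_same[OF S n])
    \<comment> \<open>On the diagonal the same series is also \<open>mu' a b B n n\<close>, which is
      compared with \<open>b n n\<close>.\<close>
    show "(\<Sum>k. ?f n n k) \<le> ?\<theta> * b n n"
      using n mu'_eq[of n n] mu'_le[of n n] bp[of n n]
      by (intro summable_suminf_leI(2)[OF f_nonneg]) auto
  next
    fix n j :: nat assume nj: "1 \<le> n" "n \<le> j"
    let ?K = "SUP m\<in>{j..}. ennreal (a m n / a m j)"
    have K: "?K < top" using sup_finite nj by (auto simp: idx_ge_def)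
    have "w m n \<le> enn2real ?K * w m j" if "j \<le> m" for m
    proof -
      have "ennreal (a m n / a m j) \<le> ?K" using that by (intro SUP_upper) auto
      then have "a m n / a m j \<le> enn2real ?K"
        using K by (metis enn2real_ennreal enn2real_mono enn2real_nonneg ennreal_neg linorder_linear
          order_trans)
      \<comment> \<open>As \<open>n \<le> j \<le> m\<close>, both weights lie in the
        \<open>a\<close> branch.\<close>
      then show ?thesis using ap[of j m] nj that by (simp add: w_def divide_le_eq)
    qed
    then show "\<exists>K. \<forall>m\<ge>j. w m n \<le> K * w m j" by blast
  qed (use theta_1 green_Suc_left[OF S] green_Suc_right[OF S] green_comp[OF S] in auto)
  from perturbed_green.general_dichotomy_perturbed[OF this]
  show ?thesis
    by (rule general_dichotomy_cong[rotated]) (auto simp: sigma_eq w_def)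
qed

end
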